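(* Let $\ell$ denote the Lebesgue measure on $\mathbb{R}$. Let $h : \mathbb{R} \to \mathbb{R}$ be a Borel measurable map preserving the standard Cauchy measure. Let $j : \mathbb{R} \to \mathbb{R}$ be a Borel measurable map such that $\ell(\{x \in \mathbb{R} : j(x) = c\}) < 1$ for every $c \in \mathbb{R}$. Then there do not exist Borel measurable functions $f, g : \mathbb{R} \to \mathbb{R}$ such that $$f(x) + g(y) = j\left(\frac{h(x) + y}{1 - h(x) y}\right) \quad \text{for all } x, y \in \mathbb{R} \text{ with } h(x) y \neq 1.$$
   Context: The standard Cauchy measure $\mu$ is the probability measure on $\mathbb{R}$ with density $\frac{1}{\pi(1+x^2)}$ with respect to Lebesgue measure. A Borel measurable map $h:\mathbb{R}\to\mathbb{R}$ preserves $\mu$ if $\mu(h^{-1}(A)) = \mu(A)$ for every Borel set $A \subseteq \mathbb{R}$. *)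

theory Defs
  imports "HOL-Analysis.Analysis"
begin

definition cauchy_measure :: "real measure" where
  "cauchy_measure = density lborel (\<lambda>x. ennreal (1 / (pi * (1 + x\<^sup>2))))"

definition preserves_cauchy :: "(real \<Rightarrow> real) \<Rightarrow> bool" where
  "preserves_cauchy h \<longleftrightarrow>
     (\<forall>A \<in> sets borel. emeasure cauchy_measure (h -` A) = emeasure cauchy_measure A)"

end

theory Submission
  imports Defs
begin

text \<open>
  Put \<open>T a y = (a + y) / (1 - a * y)\<close>. In the coordinate \<open>y = tan t\<close> this is the rotation by
  \<open>arctan a\<close> of \<open>\<real>/\<pi>\<int>\<close>, so it preserves the Cauchy measure. If \<open>f x + g y = j (T (h x) y)\<close>, then
  the integral of \<open>arctan (f x + g y)\<close> against the Cauchy measure in \<open>y\<close> equals that of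
  \<open>arctan \<circ> j\<close> and so does not depend on \<open>x\<close>; as it is strictly increasing in \<open>f x\<close>, the
  function \<open>f\<close> is constant. With \<open>y = 0\<close> this says that \<open>j\<close> is constant on the range of \<open>h\<close>,
  which has full measure because \<open>h\<close> preserves the Cauchy measure.
\<close>

text \<open>The antiderivative \<open>arctan x / pi\<close> has a limit at infinity, so the
  half-line from 0 upwards has finite mass; reflection in 0 gives the other half. Only finiteness
  matters here, never the total mass.\<close>

lemma integrable_cauchy_density:
  "integrable lborel (\<lambda>x::real. 1 / (pi * (1 + x\<^sup>2)))"
proof (rule integrableI_bounded)
  let ?d = "\<lambda>x::real. ennreal (1 / (pi * (1 + x\<^sup>2)))"
  have half: "(\<integral>\<^sup>+x. ?d x * indicator {0..} x \<partial>lborel) = ennreal ((1 / pi) * (pi / 2) - arctan 0 / pi)"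
  proof (rule nn_integral_FTC_atLeast)
    show "((\<lambda>x. arctan x / pi) has_real_derivative 1 / (pi * (1 + x\<^sup>2))) (at x)" for x :: real
      using DERIV_cdivide[OF DERIV_arctan, of pi x] by (simp add: field_simps)
    have "((\<lambda>x. (1 / pi) * arctan x) \<longlongrightarrow> (1 / pi) * (pi / 2)) at_top"
      by (intro tendsto_intros tendsto_arctan_at_top)
    then show "((\<lambda>x. arctan x / pi) \<longlongrightarrow> (1 / pi) * (pi / 2)) at_top"
      by simp
  qed auto
  have "(\<integral>\<^sup>+x. ?d x * indicator {..0} x \<partial>lborel) =
        (\<integral>\<^sup>+x. ?d x * indicator {..0} x \<partial>distr lborel borel uminus)"
    by (simp add: lborel_distr_uminus)
  also have "\<dots> = (\<integral>\<^sup>+x. ?d x * indicator {0..} x \<partial>lborel)"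
    by (subst nn_integral_distr) (auto intro!: nn_integral_cong simp: indicator_def)
  finally have half': "(\<integral>\<^sup>+x. ?d x * indicator {..0} x \<partial>lborel) =
        (\<integral>\<^sup>+x. ?d x * indicator {0..} x \<partial>lborel)" .
  \<comment> \<open>The two half-lines overlap in the point 0, so pointwise there is only an
    inequality, which is enough for a bound.\<close>
  have "(\<integral>\<^sup>+x. ?d x \<partial>lborel) \<le>
        (\<integral>\<^sup>+x. ?d x * indicator {..0} x + ?d x * indicator {0..} x \<partial>lborel)"
    by (intro nn_integral_mono) (auto simp: indicator_def)
  also have "\<dots> = (\<integral>\<^sup>+x. ?d x * indicator {..0} x \<partial>lborel) + (\<integral>\<^sup>+x. ?d x * indicator {0..} x \<partial>lborel)"
    by (rule nn_integral_add) auto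
  also have "\<dots> < \<infinity>"
    unfolding half' half infinity_ennreal_def ennreal_add_less_top by (intro conjI ennreal_less_top)
  finally have "(\<integral>\<^sup>+x. ?d x \<partial>lborel) < \<infinity>" .
  then show "(\<integral>\<^sup>+x. ennreal (norm (1 / (pi * (1 + x\<^sup>2)))) \<partial>lborel) < \<infinity>"
    by simp
qed simp

lemma sets_cauchy_measure [simp, measurable_cong]: "sets cauchy_measure = sets borel"
  and space_cauchy_measure [simp]: "space cauchy_measure = UNIV"
  by (simp_all add: cauchy_measure_def)

text \<open>The density is strictly positive everywhere, so the Cauchy and Lebesgue measures have
  the same null sets.\<close>

lemma AE_cauchy_measure_iff: "(AE x in cauchy_measure. P x) \<longleftrightarrow> (AE x in lborel. P x)"
proof -
  have "0 < ennreal (1 / (pi * (1 + x\<^sup>2)))" for x :: real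
    by (simp add: add_pos_nonneg)
  then show ?thesis
    unfolding cauchy_measure_def by (subst AE_density) simp_all
qed

text \<open>Passes to the gauge integral, the setting of the change of variables theorem applied
  below.\<close>

lemma emeasure_cauchy_measure:
  assumes "A \<in> sets borel"
  shows "emeasure cauchy_measure A =
    ennreal (integral UNIV (\<lambda>x. indicator A x * (1 / (pi * (1 + x\<^sup>2)))))"
    and "(\<lambda>x. indicator A x * (1 / (pi * (1 + x\<^sup>2)))) absolutely_integrable_on (UNIV::real set)"
proof -
  let ?f = "\<lambda>x::real. indicator A x * (1 / (pi * (1 + x\<^sup>2))) :: real"
  have int: "integrable lborel ?f"
    using integrable_mult_indicator[OF _ integrable_cauchy_density, of A] assms by simp
  have "emeasure cauchy_measure A = (\<integral>\<^sup>+x. ennreal (?f x) \<partial>lborel)"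
    using assms unfolding cauchy_measure_def
    by (subst emeasure_density) (auto intro!: nn_integral_cong simp: indicator_def)
  also have "\<dots> = ennreal (integral\<^sup>L lborel ?f)"
    by (intro nn_integral_eq_integral int) auto
  also have "integral\<^sup>L lborel ?f = integral UNIV ?f"
    using integral_lborel[OF int] by simp
  finally show "emeasure cauchy_measure A = ennreal (integral UNIV ?f)" .
  show "?f absolutely_integrable_on UNIV"
    using int by (simp add: set_integrable_def integrable_completion)
qed

interpretation cauchy_measure: finite_measure cauchy_measure
  by (rule finite_measureI) (simp add: emeasure_cauchy_measure(1))

text \<open>The rotation is treated by a change of variables in \<open>y\<close> itself, without the
  coordinate \<open>tan t\<close>. The map is a bijection between the complements of two sets with
  at most one point each, and its Jacobian compensates the change of density.\<close>

lemma distr_cauchy_measure_rotation: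
  "distr cauchy_measure borel (\<lambda>y. (a + y) / (1 - a * y)) = cauchy_measure"
proof (rule measure_eqI)
  fix A :: "real set"
  assume "A \<in> sets (distr cauchy_measure borel (\<lambda>y. (a + y) / (1 - a * y)))"
  then have A: "A \<in> sets borel" by simp
  define T where "T = (\<lambda>y. (a + y) / (1 - a * y))"
  define D where "D = (\<lambda>y. (1 + a\<^sup>2) / (1 - a * y)\<^sup>2)"
  \<comment> \<open>At the pole, division by zero gives \<open>T\<close> the value 0; removing this
    point restores injectivity.\<close>
  define S where "S = {y. a * y \<noteq> 1}"
  define d :: "real \<Rightarrow> real" where "d = (\<lambda>x. 1 / (pi * (1 + x\<^sup>2)))"
  have T [measurable]: "T \<in> borel_measurable borel"
    unfolding T_def by measurable
  have TA: "T -` A \<in> sets borel"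
    using measurable_sets[OF T A] by simp
  have S: "S \<in> sets borel"
    unfolding S_def by measurable
  have pos: "1 + a\<^sup>2 > 0"
    by (simp add: add_pos_nonneg)
  \<comment> \<open>The inverse is the rotation by \<open>- arctan a\<close>.\<close>
  have inverse: "(T y - a) / (1 + a * T y) = y" "1 + a * T y \<noteq> 0" if "y \<in> S" for y
  proof -
    have ne: "1 - a * y \<noteq> 0" using that by (simp add: S_def)
    have eq: "1 + a * T y = (1 + a\<^sup>2) / (1 - a * y)" "T y - a = y * (1 + a\<^sup>2) / (1 - a * y)"
      using ne by (simp_all add: T_def field_simps power2_eq_square)
    show "1 + a * T y \<noteq> 0" "(T y - a) / (1 + a * T y) = y"
      unfolding eq using ne pos by auto
  qed
  have inj: "inj_on T S"
    by (metis inj_onI inverse(1))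
  have image: "T ` S = {z. 1 + a * z \<noteq> 0}"
  proof
    show "T ` S \<subseteq> {z. 1 + a * z \<noteq> 0}"
      using inverse(2) by auto
    show "{z. 1 + a * z \<noteq> 0} \<subseteq> T ` S"
    proof clarify
      fix z assume ne: "1 + a * z \<noteq> 0"
      define y where "y = (z - a) / (1 + a * z)"
      have eq: "1 - a * y = (1 + a\<^sup>2) / (1 + a * z)" "a + y = z * (1 + a\<^sup>2) / (1 + a * z)"
        using ne by (simp_all add: y_def field_simps power2_eq_square)
      have "y \<in> S"
        using eq(1) pos ne by (auto simp: S_def)
      moreover have "T y = z"
        unfolding T_def eq using pos ne by simp
      ultimately show "z \<in> T ` S" by blast
    qed
  qed
  have deriv: "(T has_field_derivative D y) (at y within S)" if "y \<in> S" for y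
    using that unfolding T_def D_def S_def
    by (auto intro!: derivative_eq_intros simp: field_simps power2_eq_square)
  \<comment> \<open>By the two-squares identity, \<open>1 + (T y)\<^sup>2\<close> equals
    \<open>D y * (1 + y\<^sup>2)\<close>, so the Jacobian cancels.\<close>
  have dens: "\<bar>D y\<bar> * d (T y) = d y" if "y \<in> S" for y
  proof -
    have ne: "1 - a * y \<noteq> 0" using that by (simp add: S_def)
    have "1 + (T y)\<^sup>2 = ((1 - a * y)\<^sup>2 + (a + y)\<^sup>2) / (1 - a * y)\<^sup>2"
      using ne by (simp add: T_def power_divide add_divide_distrib[of "(1 - a * y)\<^sup>2"])
    also have "(1 - a * y)\<^sup>2 + (a + y)\<^sup>2 = (1 + a\<^sup>2) * (1 + y\<^sup>2)"
      by (simp add: power2_eq_square algebra_simps)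
    finally have eq: "1 + (T y)\<^sup>2 = (1 + a\<^sup>2) * (1 + y\<^sup>2) / (1 - a * y)\<^sup>2" .
    have cancel: "\<bar>p / q\<bar> * (1 / (pi * (p * r / q))) = 1 / (pi * r)" if "p > 0" "q > 0" for p q r :: real
      using that by simp
    show ?thesis
      unfolding d_def eq D_def using ne pos by (intro cancel) auto
  qed
  \<comment> \<open>For \<open>a = 0\<close> both exceptional sets are empty, so the singleton
    bounds below hold in that case too.\<close>
  have "a \<noteq> 0 \<Longrightarrow> z = - 1 / a" if "1 + a * z = 0" for z
    using that by (subst nonzero_eq_divide_eq) (auto simp: mult.commute)
  then have "{y. a * y = 1} \<subseteq> {1 / a}" "{z. 1 + a * z = 0} \<subseteq> {- 1 / a}"
    by (auto simp: eq_divide_eq mult.commute) force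
  then have finite: "finite {y. a * y = 1}" "finite {z. 1 + a * z = 0}"
    by (auto intro: finite_subset)
  let ?f = "\<lambda>z. indicator A z * d z" and ?g = "\<lambda>y. indicator (T -` A) y * d y"
  have f: "?f absolutely_integrable_on UNIV"
    using emeasure_cauchy_measure(2)[OF A] by (simp add: d_def)
  have "T ` S \<in> sets borel"
    unfolding image by measurable
  then have fS: "?f absolutely_integrable_on (T ` S)"
    using set_integrable_subset[OF f] by simp
  have "integral (T ` S) ?f = integral S (\<lambda>y. \<bar>D y\<bar> * ?f (T y))"
    using has_absolute_integral_change_of_variables_1'[OF _ deriv inj, where f = ?f and b = "integral (T ` S) ?f"]
      S fS by simp
  also have "\<dots> = integral S ?g"
  proof (rule integral_cong)
    show "\<bar>D y\<bar> * ?f (T y) = ?g y" if "y \<in> S" for y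
      using dens[OF that] by (simp add: indicator_def)
  qed
  also have "\<dots> = integral UNIV ?g"
    by (rule integral_spike_set)
       (rule negligible_subset[OF negligible_finite[OF finite(1)]], auto simp: S_def)+
  finally have "integral UNIV ?g = integral (T ` S) ?f" ..
  also have "\<dots> = integral UNIV ?f"
    by (rule integral_spike_set)
       (rule negligible_subset[OF negligible_finite[OF finite(2)]], auto simp: image)+
  finally have "emeasure cauchy_measure (T -` A) = emeasure cauchy_measure A"
    by (simp add: emeasure_cauchy_measure(1) A TA d_def)
  then show "emeasure (distr cauchy_measure borel (\<lambda>y. (a + y) / (1 - a * y))) A = emeasure cauchy_measure A"
    using A T by (subst emeasure_distr) (simp_all add: T_def)
qed simp

text \<open>Since \<open>arctan\<close> is bounded, the integrals exist for any measurable
  \<open>g\<close>; since it is strictly increasing, they detect a shift.\<close>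

lemma (in finite_measure) integral_arctan_shift_strict_mono:
  assumes [measurable]: "g \<in> borel_measurable M"
    and "emeasure M (space M) \<noteq> 0" and "s < t"
  shows "(\<integral>y. arctan (s + g y) \<partial>M) < (\<integral>y. arctan (t + g y) \<partial>M)"
proof -
  have int: "integrable M (\<lambda>y. arctan (r + g y))" for r
  proof (rule integrable_const_bound[where B = "pi / 2"])
    have "\<bar>arctan u\<bar> \<le> pi / 2" for u :: real
      using arctan_bounded[of u] by linarith
    then show "AE y in M. norm (arctan (r + g y)) \<le> pi / 2"
      by (intro AE_I2) (simp only: real_norm_def)
  qed measurable
  show ?thesis
    using assms(2,3) by (intro integral_less_AE_space int) (auto simp: arctan_less_iff)
qed

theorem theorem1p3:
  fixes h j :: "real \<Rightarrow> real"
  assumes "h \<in> borel_measurable borel"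
    and "preserves_cauchy h"
    and "j \<in> borel_measurable borel"
    and "\<And>c. emeasure lborel {x. j x = c} < 1"
  shows "\<not> (\<exists>f g :: real \<Rightarrow> real.
           f \<in> borel_measurable borel \<and> g \<in> borel_measurable borel \<and>
           (\<forall>x y. h x * y \<noteq> 1 \<longrightarrow> f x + g y = j ((h x + y) / (1 - h x * y))))"
proof
  note [measurable] = assms(3)
  assume "\<exists>f g :: real \<Rightarrow> real.
           f \<in> borel_measurable borel \<and> g \<in> borel_measurable borel \<and>
           (\<forall>x y. h x * y \<noteq> 1 \<longrightarrow> f x + g y = j ((h x + y) / (1 - h x * y)))"
  then obtain f g :: "real \<Rightarrow> real" where g [measurable]: "g \<in> borel_measurable borel"
    and eq: "\<And>x y. h x * y \<noteq> 1 \<Longrightarrow> f x + g y = j ((h x + y) / (1 - h x * y))"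
    by blast
  have nonzero: "emeasure cauchy_measure (space cauchy_measure) \<noteq> 0"
    using AE_cauchy_measure_iff[of "\<lambda>_. False"]
    by (simp add: eventually_False ae_filter_eq_bot_iff)
  have invariant: "(\<integral>y. arctan (f x + g y) \<partial>cauchy_measure) = (\<integral>z. arctan (j z) \<partial>cauchy_measure)" for x
  proof -
    \<comment> \<open>If \<open>h x = 0\<close>, the excluded point is 0 by the convention for
      division, which is harmless almost everywhere.\<close>
    have "h x * y \<noteq> 1" if "y \<noteq> 1 / h x" for y
      using that by (auto simp: eq_divide_eq mult.commute split: if_splits)
    then have "AE y in cauchy_measure. f x + g y = j ((h x + y) / (1 - h x * y))"
      using AE_lborel_singleton[of "1 / h x"] by (auto simp: AE_cauchy_measure_iff eq)
    then have "(\<integral>y. arctan (f x + g y) \<partial>cauchy_measure) =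
               (\<integral>y. arctan (j ((h x + y) / (1 - h x * y))) \<partial>cauchy_measure)"
      by (intro integral_cong_AE) auto
    also have "\<dots> = (\<integral>z. arctan (j z) \<partial>distr cauchy_measure borel (\<lambda>y. (h x + y) / (1 - h x * y)))"
      by (subst integral_distr) auto
    finally show ?thesis
      by (simp only: distr_cauchy_measure_rotation)
  qed
  \<comment> \<open>A strict inequality either way would separate two integrals that
    \<open>invariant\<close> makes equal.\<close>
  have const: "f x = f 0" for x
    using cauchy_measure.integral_arctan_shift_strict_mono[of g "f x" "f 0"]
      cauchy_measure.integral_arctan_shift_strict_mono[of g "f 0" "f x"] nonzero invariant
    by (cases "f x" "f 0" rule: linorder_cases) auto
  define A where "A = {z. j z = f 0 + g 0}"
  have A: "A \<in> sets borel"
    unfolding A_def by measurable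
  have "j (h x) = f 0 + g 0" for x
    using eq[of x 0] const[of x] by simp
  then have "h -` A = UNIV"
    by (auto simp: A_def)
  then have "emeasure cauchy_measure A = emeasure cauchy_measure UNIV"
    using assms(2) A by (auto simp: preserves_cauchy_def)
  then have "emeasure cauchy_measure (UNIV - A) = 0"
    using A by (subst emeasure_Diff) auto
  then have "AE x in cauchy_measure. x \<in> A"
    using A by (intro AE_I[where N = "UNIV - A"]) auto
  \<comment> \<open>The complement of the level set \<open>A\<close> is also Lebesgue null, so
    \<open>A\<close> has infinite length, against the bound 1.\<close>
  then have "emeasure lborel A = emeasure lborel (UNIV :: real set)"
    using A by (intro emeasure_eq_AE) (auto simp: AE_cauchy_measure_iff)
  then show False
    using assms(4)[of "f 0 + g 0"] by (simp add: A_def)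
qed

end
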